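(* All quotient graphs are quasi-crystallographs: if $\mathcal{G}'\subseteq\mathcal{G}$ is an inclusion of crystallographs on the same finite set of nodes, both disjoint unions of graphs of type $A$, $B$, $C$, $D$ and $BC$, then the quotient graph $\mathcal{G}\setminus\mathcal{G}'$ is a quasi-crystallograph.
   Context: Bichromatic graphs: unoriented straight edges $\{i,j\}$ ($i\ne j$) and loop edges $\{k\}$, each coloured red or green, such that two distinct edges with the same underlying node set have different colours. Crystallograph: a bichromatic graph such that (1) for any three distinct nodes $i,j,k$, if there are straight edges $\{i,j\}$, $\{j,k\}$ then there is a straight edge $\{i,k\}$, red if the first two have the same colour and green otherwise; (2) if a node $i$ is incident to a loop edge and to a straight edge $\{i,j\}$, then both the red and the green straight edge $\{i,j\}$ are present, as well as a loop edge at $j$ of the same colour as the one at $i$. Quasi-crystallograph: a bichromatic graph satisfying (1), satisfying (2) for red loop edges, and satisfying the following weakening of (2) for green loop edges: if a node $i$ is incident to a green loop edge and to a straight edge $\{i,j\}$, then both the red and the green straight edge $\{i,j\}$ are present (but a green loop at $j$ is not required). Graphs on $m\ge1$ nodes: type $A$: exactly all red straight edges (an isolated node for $m=1$); type $D$ ($m\geq 2$): exactly all red and green straight edges; type $B$ (resp. $C$, $BC$): all red and green straight edges and a red (resp. green, resp. both a red and a green) loop at every node. A "red component" is a connected component of type $A$ (isolated nodes included); any other connected component is "bichromatic". Quotient graph $\mathcal{G}\setminus\mathcal{G}'$: its nodes are the red components of $\mathcal{G}'$, and its edges are exactly the following. (i) If $\mathcal{G}$ has a straight edge between nodes of two distinct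 red components $\mathcal{G}'(i)$, $\mathcal{G}'(j)$ of $\mathcal{G}'$, put a straight edge of the same colour between them. (ii) If $\mathcal{G}$ has a green straight edge between two nodes of a red component $\mathcal{G}'(i)$, put a green loop at $\mathcal{G}'(i)$. (iii) If $\mathcal{G}$ has a straight edge from a node of a red component $\mathcal{G}'(i)$ to a node of a bichromatic component of $\mathcal{G}'$, put a red loop at $\mathcal{G}'(i)$. (iv) If $\mathcal{G}$ has a loop edge at a node of a red component $\mathcal{G}'(i)$, put a loop of the same colour at $\mathcal{G}'(i)$. (At most one edge per colour is kept.) *)

theory Defs
  imports Main
begin

datatype colour = Red | Green

text \<open>
  An edge is a pair of its underlying node set (\<open>{i, j}\<close> for a straight edge, \<open>{k}\<close> for a loop) and
  its colour. As the edges form a set of such pairs, two distinct edges with the same underlying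
  node set automatically have different colours.
\<close>

record 'a cgraph =
  nodes :: "'a set"
  edges :: "('a set \<times> colour) set"

definition bichromatic_graph :: "'a cgraph \<Rightarrow> bool" where
  "bichromatic_graph G \<longleftrightarrow>
     (\<forall>(e, c) \<in> edges G. \<exists>i\<in>nodes G. \<exists>j\<in>nodes G. e = {i, j})"

definition straight :: "'a cgraph \<Rightarrow> colour \<Rightarrow> 'a \<Rightarrow> 'a \<Rightarrow> bool" where
  "straight G c i j \<longleftrightarrow> i \<noteq> j \<and> ({i, j}, c) \<in> edges G"

definition loop :: "'a cgraph \<Rightarrow> colour \<Rightarrow> 'a \<Rightarrow> bool" where
  "loop G c k \<longleftrightarrow> ({k}, c) \<in> edges G"

definition triangle_condition :: "'a cgraph \<Rightarrow> bool" where
  "triangle_condition G \<longleftrightarrow>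
     (\<forall>i j k c d. i \<noteq> j \<and> j \<noteq> k \<and> i \<noteq> k \<and> straight G c i j \<and> straight G d j k \<longrightarrow>
        straight G (if c = d then Red else Green) i k)"

definition loop_condition :: "'a cgraph \<Rightarrow> colour \<Rightarrow> bool" where
  "loop_condition G c \<longleftrightarrow>
     (\<forall>i j d. loop G c i \<and> straight G d i j \<longrightarrow>
        straight G Red i j \<and> straight G Green i j \<and> loop G c j)"

definition weak_loop_condition :: "'a cgraph \<Rightarrow> colour \<Rightarrow> bool" where
  "weak_loop_condition G c \<longleftrightarrow>
     (\<forall>i j d. loop G c i \<and> straight G d i j \<longrightarrow> straight G Red i j \<and> straight G Green i j)"

definition crystallograph :: "'a cgraph \<Rightarrow> bool" where
  "crystallograph G \<longleftrightarrow>
     bichromatic_graph G \<and> triangle_condition G \<and> (\<forall>c. loop_condition G c)"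

definition quasi_crystallograph :: "'a cgraph \<Rightarrow> bool" where
  "quasi_crystallograph G \<longleftrightarrow>
     bichromatic_graph G \<and> triangle_condition G \<and>
     loop_condition G Red \<and> weak_loop_condition G Green"

definition all_straight :: "'a set \<Rightarrow> colour \<Rightarrow> ('a set \<times> colour) set" where
  "all_straight V c = {({i, j}, c) | i j. i \<in> V \<and> j \<in> V \<and> i \<noteq> j}"

definition all_loops :: "'a set \<Rightarrow> colour \<Rightarrow> ('a set \<times> colour) set" where
  "all_loops V c = {({k}, c) | k. k \<in> V}"

text \<open>In the five types, the bound on \<^const>\<open>card\<close> also forces the node set to be finite.\<close>

definition type_A :: "'a cgraph \<Rightarrow> bool" where
  "type_A G \<longleftrightarrow> card (nodes G) \<ge> 1 \<and> edges G = all_straight (nodes G) Red"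

definition type_D :: "'a cgraph \<Rightarrow> bool" where
  "type_D G \<longleftrightarrow> card (nodes G) \<ge> 2 \<and>
     edges G = all_straight (nodes G) Red \<union> all_straight (nodes G) Green"

definition type_B :: "'a cgraph \<Rightarrow> bool" where
  "type_B G \<longleftrightarrow> card (nodes G) \<ge> 1 \<and>
     edges G = all_straight (nodes G) Red \<union> all_straight (nodes G) Green \<union>
       all_loops (nodes G) Red"

definition type_C :: "'a cgraph \<Rightarrow> bool" where
  "type_C G \<longleftrightarrow> card (nodes G) \<ge> 1 \<and>
     edges G = all_straight (nodes G) Red \<union> all_straight (nodes G) Green \<union>
       all_loops (nodes G) Green"

definition type_BC :: "'a cgraph \<Rightarrow> bool" where
  "type_BC G \<longleftrightarrow> card (nodes G) \<ge> 1 \<and>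
     edges G = all_straight (nodes G) Red \<union> all_straight (nodes G) Green \<union>
       all_loops (nodes G) Red \<union> all_loops (nodes G) Green"

definition disjoint_union_of_types :: "'a cgraph \<Rightarrow> bool" where
  "disjoint_union_of_types G \<longleftrightarrow>
     (\<exists>\<H>. (\<forall>H\<in>\<H>. type_A H \<or> type_B H \<or> type_C H \<or> type_D H \<or> type_BC H) \<and>
          pairwise (\<lambda>H K. disjnt (nodes H) (nodes K)) \<H> \<and>
          nodes G = (\<Union>H\<in>\<H>. nodes H) \<and> edges G = (\<Union>H\<in>\<H>. edges H))"

definition induced_subgraph :: "'a cgraph \<Rightarrow> 'a set \<Rightarrow> 'a cgraph" where
  "induced_subgraph G W = \<lparr>nodes = W, edges = {(e, c) \<in> edges G. e \<subseteq> W}\<rparr>"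

definition adjacency :: "'a cgraph \<Rightarrow> ('a \<times> 'a) set" where
  "adjacency G = {(i, j). \<exists>c. straight G c i j}"

definition connected_components :: "'a cgraph \<Rightarrow> 'a cgraph set" where
  "connected_components G = (\<lambda>i. induced_subgraph G ((adjacency G)\<^sup>* `` {i})) ` nodes G"

definition red_components :: "'a cgraph \<Rightarrow> 'a cgraph set" where
  "red_components G = {H \<in> connected_components G. type_A H}"

definition bichromatic_components :: "'a cgraph \<Rightarrow> 'a cgraph set" where
  "bichromatic_components G = {H \<in> connected_components G. \<not> type_A H}"

text \<open>
  The nodes of the quotient of \<open>G\<close> by \<open>G'\<close> are the red components of \<open>G'\<close>, which are themselves
  graphs.
\<close>

definition quotient_graph :: "'a cgraph \<Rightarrow> 'a cgraph \<Rightarrow> 'a cgraph cgraph" where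
  "quotient_graph G G' =
     \<lparr>nodes = red_components G',
      edges =
        {({I, J}, c) | I J c. I \<in> red_components G' \<and> J \<in> red_components G' \<and> I \<noteq> J \<and>
           (\<exists>i\<in>nodes I. \<exists>j\<in>nodes J. straight G c i j)} \<union>
        {({I}, Green) | I. I \<in> red_components G' \<and>
           (\<exists>i\<in>nodes I. \<exists>j\<in>nodes I. straight G Green i j)} \<union>
        {({I}, Red) | I. I \<in> red_components G' \<and>
           (\<exists>i\<in>nodes I. \<exists>K\<in>bichromatic_components G'. \<exists>k\<in>nodes K. \<exists>c. straight G c i k)} \<union>
        {({I}, c) | I c. I \<in> red_components G' \<and> (\<exists>i\<in>nodes I. loop G c i)}\<rparr>"

end

theory Submission
  imports Defs
begin

text \<open>
  The proof rests on one property of a node of \<open>G\<close>: call it doubled if it is joined in both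
  colours to each of its neighbours. In a graph satisfying the triangle condition, a single
  neighbour joined in both colours already makes a node doubled (\<open>doubledI_double_edge\<close>): going
  around a triangle through the double edge reaches any other neighbour in both colours. Hence
  being doubled spreads along straight edges (\<open>doubled_neighbour\<close>), and by the loop condition a
  node with a loop is doubled as well.

  Each of the three ways in which a loop can arise in the quotient produces a doubled node of
  \<open>G\<close> in the red component that carries it: a green edge inside the component runs parallel to a
  red one; a neighbour in a bichromatic component of \<open>G'\<close> is itself doubled, because the types
  \<open>B\<close>, \<open>C\<close>, \<open>D\<close> and \<open>BC\<close> all have a loop or a double edge at every node; and a loop of \<open>G\<close> has
  just been dealt with. As a red component is connected in \<open>G\<close>, all its nodes are doubled, so its
  straight edges in the quotient come in both colours (\<open>quotient_loop_doubled\<close>).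

  A red loop moreover passes to a neighbour \<open>J\<close> in the quotient: a loop of \<open>G\<close> is carried along
  the straight edges of \<open>G\<close>, and an edge to a bichromatic component is composed with the edge
  from \<open>J\<close> by the triangle condition. A green loop coming from an edge inside the component need
  not pass on, for instance to a component with only one node; this is why the quotient is only a
  quasi-crystallograph.

  The triangle condition itself descends to the quotient because a red component of \<open>G'\<close> is a
  clique of red edges of \<open>G\<close>, and composing with a red edge preserves colours. An edge between
  two red components can therefore be moved to end at any prescribed node of either
  (\<open>straight_move_end\<close>).
\<close>

section \<open>Doubled nodes\<close>

definition doubled :: "'a cgraph \<Rightarrow> 'a \<Rightarrow> bool" where
  "doubled G i \<longleftrightarrow> (\<forall>j d c. straight G d i j \<longrightarrow> straight G c i j)"

lemma straight_sym: "straight G c i j \<Longrightarrow> straight G c j i"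
  by (auto simp: straight_def insert_commute)

lemma straight_mono: "edges G' \<subseteq> edges G \<Longrightarrow> straight G' c i j \<Longrightarrow> straight G c i j"
  by (auto simp: straight_def)

lemma loop_mono: "edges G' \<subseteq> edges G \<Longrightarrow> loop G' c i \<Longrightarrow> loop G c i"
  by (auto simp: loop_def)

lemma straight_compose:
  assumes "triangle_condition G" "straight G c i j" "straight G d j k" "i \<noteq> k"
  shows "straight G (if c = d then Red else Green) i k"
proof -
  have "i \<noteq> j" "j \<noteq> k"
    using assms(2,3) by (auto simp: straight_def)
  then show ?thesis
    using assms unfolding triangle_condition_def by blast
qed

lemma doubledD: "doubled G i \<Longrightarrow> straight G d i j \<Longrightarrow> straight G c i j"
  unfolding doubled_def by (elim allE impE)

lemma doubledI_double_edge:
  assumes tri: "triangle_condition G" and both: "\<And>c. straight G c i m"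
  shows "doubled G i"
  unfolding doubled_def
proof (intro allI impI)
  fix j d c
  assume ij: "straight G d i j"
  show "straight G c i j"
  proof (cases "j = m")
    case True
    then show ?thesis using both by simp
  next
    case False
    have "straight G (if d = Red then Red else Green) j m"
      using straight_compose[OF tri straight_sym[OF ij] both[of Red]] False by simp
    then have "straight G d j m" by (cases d) simp_all
    then have mj: "straight G d m j" by (rule straight_sym)
    have ne: "i \<noteq> j" using ij by (auto simp: straight_def)
    \<comment> \<open>The colour of the first side is free, so the third side can be given either colour.\<close>
    define b where "b = (if c = Red then d else if d = Red then Green else Red)"
    have b: "(if b = d then Red else Green) = c"
      by (cases c; cases d) (simp_all add: b_def)
    show ?thesis
      using straight_compose[OF tri both[of b] mj ne] unfolding b .
  qed
qed

lemma doubled_neighbour: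
  assumes "triangle_condition G" "doubled G i" "straight G d i j"
  shows "doubled G j"
proof (rule doubledI_double_edge[OF assms(1)])
  show "straight G c j i" for c
    using doubledD[OF assms(2,3)] by (rule straight_sym)
qed

lemma doubledI_loop:
  assumes "crystallograph G" "loop G b i"
  shows "doubled G i"
  unfolding doubled_def
proof (intro allI impI)
  fix j d c
  assume "straight G d i j"
  then have "straight G Red i j \<and> straight G Green i j"
    using assms unfolding crystallograph_def loop_condition_def by blast
  then show "straight G c i j" by (cases c) auto
qed

section \<open>Connected components of a disjoint union of the five types\<close>

definition five_type :: "'a cgraph \<Rightarrow> bool" where
  "five_type H \<longleftrightarrow> type_A H \<or> type_B H \<or> type_C H \<or> type_D H \<or> type_BC H"

lemma five_type_edge:
  assumes "five_type H" "(e, c) \<in> edges H"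
  shows "e \<noteq> {}" "e \<subseteq> nodes H"
  using assms
  by (auto simp: five_type_def type_A_def type_B_def type_C_def type_D_def type_BC_def
      all_straight_def all_loops_def)

lemma all_straightI: "i \<in> V \<Longrightarrow> j \<in> V \<Longrightarrow> i \<noteq> j \<Longrightarrow> ({i, j}, c) \<in> all_straight V c"
  unfolding all_straight_def by blast

lemma five_type_red_clique:
  assumes "five_type H" "i \<in> nodes H" "j \<in> nodes H" "i \<noteq> j"
  shows "straight H Red i j"
  using assms all_straightI[OF assms(2-4)]
  by (auto simp: five_type_def type_A_def type_B_def type_C_def type_D_def type_BC_def
      straight_def)

text \<open>
  In type \<open>D\<close> the double edge exists because of the lower bound of two on the number of nodes.
\<close>

lemma five_type_loop_or_double_edge:
  assumes "five_type H" "\<not> type_A H" "k \<in> nodes H"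
  shows "(\<exists>c. loop H c k) \<or> (\<exists>m. \<forall>c. straight H c k m)"
proof (cases "type_D H")
  case True
  have "nodes H \<noteq> {k}"
    using True by (auto simp: type_D_def)
  then obtain m where m: "m \<in> nodes H" "m \<noteq> k"
    using assms(3) by blast
  have "straight H c k m" for c
    using True m all_straightI[OF assms(3) m(1)] by (cases c) (auto simp: type_D_def straight_def)
  then show ?thesis by blast
next
  case False
  then show ?thesis
    using assms
    by (auto simp: five_type_def type_B_def type_C_def type_BC_def all_loops_def loop_def)
qed

lemma connected_component_edges:
  "H \<in> connected_components G \<Longrightarrow> edges H \<subseteq> edges G"
  by (auto simp: connected_components_def induced_subgraph_def)

lemma connected_components_disjoint:
  assumes "H \<in> connected_components G" "K \<in> connected_components G"
    and "x \<in> nodes H" "x \<in> nodes K"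
  shows "H = K"
proof -
  obtain i j where
    H: "H = induced_subgraph G ((adjacency G)\<^sup>* `` {i})" and
    K: "K = induced_subgraph G ((adjacency G)\<^sup>* `` {j})"
    using assms(1,2) by (auto simp: connected_components_def)
  have "sym (adjacency G)"
    by (auto simp: sym_def adjacency_def intro: straight_sym)
  then have "sym ((adjacency G)\<^sup>*)" by (rule sym_rtrancl)
  moreover have "(i, x) \<in> (adjacency G)\<^sup>*" "(j, x) \<in> (adjacency G)\<^sup>*"
    using assms(3,4) H K by (auto simp: induced_subgraph_def)
  ultimately have "(adjacency G)\<^sup>* `` {i} = (adjacency G)\<^sup>* `` {j}"
    by (auto dest: symD intro: rtrancl_trans)
  then show ?thesis using H K by simp
qed

text \<open>
  No edge joins two members of the given family, and each member is connected by its red edges: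
  the members are the connected components.
\<close>

lemma connected_component_five_type:
  assumes "disjoint_union_of_types G" "C \<in> connected_components G"
  shows "five_type C"
proof -
  obtain \<H> where \<H>: "(\<forall>H\<in>\<H>. five_type H) \<and>
      pairwise (\<lambda>H K. disjnt (nodes H) (nodes K)) \<H> \<and>
      nodes G = (\<Union>H\<in>\<H>. nodes H) \<and> edges G = (\<Union>H\<in>\<H>. edges H)"
    using assms(1) unfolding disjoint_union_of_types_def five_type_def by (rule exE)
  have types: "five_type H" if "H \<in> \<H>" for H
    using \<H> that by simp
  from \<H> have disj: "pairwise (\<lambda>H K. disjnt (nodes H) (nodes K)) \<H>"
    and nodesG: "nodes G = (\<Union>H\<in>\<H>. nodes H)" and edgesG: "edges G = (\<Union>H\<in>\<H>. edges H)"
    by simp_all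
  obtain i where i: "i \<in> nodes G" and C: "C = induced_subgraph G ((adjacency G)\<^sup>* `` {i})"
    using assms(2) by (auto simp: connected_components_def)
  obtain H where H: "H \<in> \<H>" "i \<in> nodes H"
    using i nodesG by auto
  have edge_in_H: "(e, c) \<in> edges H" if e: "(e, c) \<in> edges G" "x \<in> e" "x \<in> nodes H" for e c x
  proof -
    obtain K where K: "K \<in> \<H>" "(e, c) \<in> edges K"
      using e(1) edgesG by auto
    then have "x \<in> nodes K"
      using five_type_edge(2)[OF types] e(2) by blast
    then have "K = H"
      using disj H(1) K(1) e(3) by (auto simp: pairwise_def disjnt_def)
    then show ?thesis using K by simp
  qed
  have "j \<in> nodes H" if "(i, j) \<in> (adjacency G)\<^sup>*" for j
    using that
  proof (induction rule: rtrancl_induct)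
    case base
    then show ?case by (rule H(2))
  next
    case (step x y)
    then obtain c where "({x, y}, c) \<in> edges G"
      by (auto simp: adjacency_def straight_def)
    then have "({x, y}, c) \<in> edges H"
      using edge_in_H step.IH by blast
    then show ?case using five_type_edge(2)[OF types[OF H(1)]] by blast
  qed
  moreover have "(i, j) \<in> (adjacency G)\<^sup>*" if "j \<in> nodes H" for j
  proof (cases "i = j")
    case False
    then have "straight H Red i j"
      using five_type_red_clique[OF types[OF H(1)] H(2) that] by simp
    then have "straight G Red i j"
      using straight_mono[of H G] edgesG H(1) by blast
    then show ?thesis by (auto simp: adjacency_def)
  qed simp
  ultimately have reach: "(adjacency G)\<^sup>* `` {i} = nodes H" by auto
  have "(e, c) \<in> edges G \<and> e \<subseteq> nodes H \<longleftrightarrow> (e, c) \<in> edges H" for e c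
  proof
    assume e: "(e, c) \<in> edges G \<and> e \<subseteq> nodes H"
    then have "e \<noteq> {}"
      using edgesG five_type_edge(1)[OF types] by blast
    then show "(e, c) \<in> edges H" using e edge_in_H by blast
  next
    assume "(e, c) \<in> edges H"
    then show "(e, c) \<in> edges G \<and> e \<subseteq> nodes H"
      using five_type_edge(2)[OF types[OF H(1)]] H(1) edgesG by blast
  qed
  then have "{(e, c) \<in> edges G. e \<subseteq> nodes H} = edges H" by auto
  then have "C = H" by (simp add: C induced_subgraph_def reach)
  then show ?thesis using types H(1) by simp
qed

lemma red_component_red_clique:
  assumes "I \<in> red_components G'" "edges G' \<subseteq> edges G"
    and "i \<in> nodes I" "j \<in> nodes I" "i \<noteq> j"
  shows "straight G Red i j"
proof -
  have "straight I Red i j"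
    using assms(1,3-5) by (intro five_type_red_clique) (auto simp: red_components_def five_type_def)
  moreover have "edges I \<subseteq> edges G"
    using assms(1,2) connected_component_edges[of I G'] by (auto simp: red_components_def)
  ultimately show ?thesis by (rule straight_mono[rotated])
qed

lemma red_components_disjoint:
  assumes "I \<in> red_components G'" "J \<in> red_components G'" "I \<noteq> J" "i \<in> nodes I" "j \<in> nodes J"
  shows "i \<noteq> j"
proof -
  have "I \<in> connected_components G'" "J \<in> connected_components G'"
    using assms(1,2) by (auto simp: red_components_def)
  then show ?thesis using connected_components_disjoint[of I G' J i] assms(3-5) by auto
qed

lemma red_bichromatic_components_disjoint:
  assumes "I \<in> red_components G'" "K \<in> bichromatic_components G'" "i \<in> nodes I" "k \<in> nodes K"
  shows "i \<noteq> k"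
proof -
  have "I \<in> connected_components G'" "K \<in> connected_components G'" "I \<noteq> K"
    using assms(1,2) by (auto simp: red_components_def bichromatic_components_def)
  then show ?thesis using connected_components_disjoint[of I G' K i] assms(3,4) by auto
qed

lemma bichromatic_component_doubled:
  assumes "crystallograph G" "edges G' \<subseteq> edges G" "disjoint_union_of_types G'"
    and K: "K \<in> bichromatic_components G'" "k \<in> nodes K"
  shows "doubled G k"
proof -
  have comp: "K \<in> connected_components G'" "\<not> type_A K"
    using K(1) by (auto simp: bichromatic_components_def)
  have sub: "edges K \<subseteq> edges G"
    using connected_component_edges[OF comp(1)] assms(2) by blast
  have "(\<exists>c. loop K c k) \<or> (\<exists>m. \<forall>c. straight K c k m)"
    using five_type_loop_or_double_edge[OF connected_component_five_type[OF assms(3) comp(1)]]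
      comp(2) K(2) by simp
  then show ?thesis
  proof
    assume "\<exists>c. loop K c k"
    then show ?thesis using doubledI_loop[OF assms(1)] loop_mono[OF sub] by blast
  next
    assume "\<exists>m. \<forall>c. straight K c k m"
    then obtain m where "\<And>c. straight G c k m"
      using straight_mono[OF sub] by blast
    moreover have "triangle_condition G"
      using assms(1) by (simp add: crystallograph_def)
    ultimately show ?thesis using doubledI_double_edge[of G k m] by simp
  qed
qed

text \<open>Composition with a red edge does not change the colour.\<close>

lemma straight_move_end:
  assumes tri: "triangle_condition G" and sub: "edges G' \<subseteq> edges G"
    and J: "J \<in> red_components G'" "j \<in> nodes J" "j' \<in> nodes J"
    and ij: "straight G c i j" and ne: "i \<noteq> j'"
  shows "straight G c i j'"
proof (cases "j = j'")
  case True
  then show ?thesis using ij by simp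
next
  case False
  then have "straight G Red j j'"
    using red_component_red_clique[OF J(1) sub J(2,3)] by simp
  then have "straight G (if c = Red then Red else Green) i j'"
    using straight_compose[OF tri ij] ne by blast
  then show ?thesis by (cases c) auto
qed

lemma doubled_red_component:
  assumes "triangle_condition G" "edges G' \<subseteq> edges G" "I \<in> red_components G'"
    and "i \<in> nodes I" "i' \<in> nodes I" "doubled G i"
  shows "doubled G i'"
proof (cases "i = i'")
  case True
  then show ?thesis using assms(6) by simp
next
  case False
  then have "straight G Red i i'"
    using red_component_red_clique[OF assms(3,2,4,5)] by simp
  then show ?thesis by (rule doubled_neighbour[OF assms(1,6)])
qed

section \<open>Edges of the quotient\<close>

lemma straight_quotient:
  "straight (quotient_graph G G') c I J \<longleftrightarrow>
     I \<in> red_components G' \<and> J \<in> red_components G' \<and> I \<noteq> J \<and>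
     (\<exists>i\<in>nodes I. \<exists>j\<in>nodes J. straight G c i j)"
    (is "?L \<longleftrightarrow> ?R")
proof
  assume ?L
  then have "I \<noteq> J" "({I, J}, c) \<in> edges (quotient_graph G G')"
    by (simp_all add: straight_def)
  then obtain I' J' where "I' \<in> red_components G'" "J' \<in> red_components G'" "{I, J} = {I', J'}"
    and "\<exists>i\<in>nodes I'. \<exists>j\<in>nodes J'. straight G c i j"
    unfolding quotient_graph_def by auto
  \<comment> \<open>An edge is an unordered pair, so its ends may appear in either order.\<close>
  moreover from this have "\<exists>i\<in>nodes I. \<exists>j\<in>nodes J. straight G c i j"
    by (auto simp: doubleton_eq_iff dest: straight_sym)
  ultimately show ?R
    using \<open>I \<noteq> J\<close> by (auto simp: doubleton_eq_iff)
next
  assume ?R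
  then have "({I, J}, c) \<in> edges (quotient_graph G G')"
    unfolding quotient_graph_def cgraph.simps by blast
  with \<open>?R\<close> show ?L by (simp add: straight_def[of "quotient_graph G G'"])
qed

lemma loop_quotient_Red:
  "loop (quotient_graph G G') Red I \<longleftrightarrow>
     I \<in> red_components G' \<and>
     ((\<exists>i\<in>nodes I. \<exists>K\<in>bichromatic_components G'. \<exists>k\<in>nodes K. \<exists>c. straight G c i k) \<or>
      (\<exists>i\<in>nodes I. loop G Red i))"
  unfolding loop_def[of "quotient_graph G G'"]
  unfolding quotient_graph_def by auto

lemma loop_quotient_Green:
  "loop (quotient_graph G G') Green I \<longleftrightarrow>
     I \<in> red_components G' \<and>
     ((\<exists>i\<in>nodes I. \<exists>j\<in>nodes I. straight G Green i j) \<or> (\<exists>i\<in>nodes I. loop G Green i))"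
  unfolding loop_def[of "quotient_graph G G'"]
  unfolding quotient_graph_def by auto

lemma quotient_loop_doubled:
  assumes crys: "crystallograph G" and sub: "edges G' \<subseteq> edges G"
    and types: "disjoint_union_of_types G'"
    and lp: "loop (quotient_graph G G') c I" and i: "i \<in> nodes I"
  shows "doubled G i"
proof -
  have tri: "triangle_condition G" using crys by (simp add: crystallograph_def)
  have I: "I \<in> red_components G'"
    using lp by (cases c) (simp_all add: loop_quotient_Red loop_quotient_Green)
  consider
      (bichromatic) x K k d where "x \<in> nodes I" "K \<in> bichromatic_components G'" "k \<in> nodes K"
        "straight G d x k"
    | (inner) x y where "x \<in> nodes I" "y \<in> nodes I" "straight G Green x y"
    | (loop) x where "x \<in> nodes I" "loop G c x"
    using lp by (cases c) (auto simp: loop_quotient_Red loop_quotient_Green)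
  then have "\<exists>x\<in>nodes I. doubled G x"
  proof cases
    case bichromatic
    then have "doubled G k"
      using bichromatic_component_doubled[OF crys sub types] by blast
    then show ?thesis
      using doubled_neighbour[OF tri _ straight_sym] bichromatic(1,4) by blast
  next
    case inner
    then have "straight G Red x y"
      using red_component_red_clique[OF I sub] by (auto simp: straight_def)
    with inner have "straight G b x y" for b by (cases b) auto
    then show ?thesis using doubledI_double_edge[OF tri] inner by blast
  next
    case loop
    then show ?thesis using doubledI_loop[OF crys] by blast
  qed
  then show ?thesis using doubled_red_component[OF tri sub I _ i] by blast
qed

lemma quotient_loop_both_colours:
  assumes "crystallograph G" "edges G' \<subseteq> edges G" "disjoint_union_of_types G'"
    and "loop (quotient_graph G G') c I" "straight (quotient_graph G G') d I J"
  shows "straight (quotient_graph G G') b I J"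
proof -
  obtain i j where "I \<in> red_components G'" "J \<in> red_components G'" "I \<noteq> J"
    and i: "i \<in> nodes I" and j: "j \<in> nodes J" and ij: "straight G d i j"
    using assms(5) unfolding straight_quotient by blast
  moreover have "straight G b i j"
    by (rule doubledD[OF quotient_loop_doubled[OF assms(1-4) i] ij])
  ultimately show ?thesis unfolding straight_quotient by blast
qed

lemma triangle_condition_quotient:
  assumes tri: "triangle_condition G" and sub: "edges G' \<subseteq> edges G"
  shows "triangle_condition (quotient_graph G G')"
  unfolding triangle_condition_def
proof (intro allI impI, elim conjE)
  fix I J K c d
  assume ne: "I \<noteq> J" "J \<noteq> K" "I \<noteq> K"
    and "straight (quotient_graph G G') c I J" "straight (quotient_graph G G') d J K"
  then obtain i j j' k where
    red: "I \<in> red_components G'" "J \<in> red_components G'" "K \<in> red_components G'" and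
    mem: "i \<in> nodes I" "j \<in> nodes J" "j' \<in> nodes J" "k \<in> nodes K" and
    ij: "straight G c i j" and jk: "straight G d j' k"
    unfolding straight_quotient by blast
  have "straight G c i j'"
    using straight_move_end[OF tri sub red(2) mem(2,3) ij]
      red_components_disjoint[OF red(1,2) ne(1) mem(1,3)] by blast
  moreover have "i \<noteq> k"
    using red_components_disjoint[OF red(1,3) ne(3) mem(1,4)] .
  ultimately have "straight G (if c = d then Red else Green) i k"
    using straight_compose[OF tri _ jk] by blast
  then show "straight (quotient_graph G G') (if c = d then Red else Green) I K"
    unfolding straight_quotient using red mem ne(3) by blast
qed

lemma quotient_red_loop_neighbour:
  assumes crys: "crystallograph G" and sub: "edges G' \<subseteq> edges G"
    and lp: "loop (quotient_graph G G') Red I" and IJ: "straight (quotient_graph G G') d I J"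
  shows "loop (quotient_graph G G') Red J"
proof -
  have tri: "triangle_condition G" using crys by (simp add: crystallograph_def)
  obtain i j where red: "I \<in> red_components G'" "J \<in> red_components G'" and ne: "I \<noteq> J"
    and i: "i \<in> nodes I" and j: "j \<in> nodes J" and ij: "straight G d i j"
    using IJ unfolding straight_quotient by blast
  have move: "straight G d j x" if "x \<in> nodes I" for x
    using straight_move_end[OF tri sub red(1) i that straight_sym[OF ij]]
      red_components_disjoint[OF red ne that j] by blast
  from lp consider
      (bichromatic) x K k c where "x \<in> nodes I" "K \<in> bichromatic_components G'" "k \<in> nodes K"
        "straight G c x k"
    | (loop) x where "x \<in> nodes I" "loop G Red x"
    unfolding loop_quotient_Red by blast
  then show ?thesis
  proof cases
    case bichromatic
    have "straight G (if d = c then Red else Green) j k"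
      using straight_compose[OF tri move[OF bichromatic(1)] bichromatic(4)]
        red_bichromatic_components_disjoint[OF red(2) bichromatic(2) j bichromatic(3)] by blast
    then show ?thesis
      unfolding loop_quotient_Red using red(2) j bichromatic(2,3) by blast
  next
    case loop
    then have "loop G Red j"
      using crys straight_sym[OF move[OF loop(1)]]
      unfolding crystallograph_def loop_condition_def by blast
    then show ?thesis
      unfolding loop_quotient_Red using red(2) j by blast
  qed
qed

lemma bichromatic_graph_quotient: "bichromatic_graph (quotient_graph G G')"
  unfolding bichromatic_graph_def quotient_graph_def by auto

theorem theorem6p3p2:
  fixes G G' :: "'a cgraph"
  assumes "crystallograph G" and "crystallograph G'"
    and "finite (nodes G)"
    and "nodes G' = nodes G" and "edges G' \<subseteq> edges G"
    and "disjoint_union_of_types G" and "disjoint_union_of_types G'"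
  shows "quasi_crystallograph (quotient_graph G G')"
proof -
  have "triangle_condition (quotient_graph G G')"
    using triangle_condition_quotient[OF _ assms(5)] assms(1) by (simp add: crystallograph_def)
  moreover have "loop_condition (quotient_graph G G') Red"
    unfolding loop_condition_def
    using quotient_loop_both_colours[OF assms(1,5,7)] quotient_red_loop_neighbour[OF assms(1,5)]
    by blast
  moreover have "weak_loop_condition (quotient_graph G G') Green"
    unfolding weak_loop_condition_def
    using quotient_loop_both_colours[OF assms(1,5,7)] by blast
  ultimately show ?thesis
    by (simp add: quasi_crystallograph_def bichromatic_graph_quotient)
qed

end
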